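(* Let $p$ be prime, let $n$ be a positive integer, and let $\alpha$ be a primitive element of $\mathrm{GF}(p^n)$. Identify the additive group of $\mathrm{GF}(p^n)$ with $\mathbb{Z}_p^n$. Then the additive form of the multiplication table for $\{1,\alpha,\alpha^2,\dots,\alpha^{n-1}\}$, that is, the $n\times n$ matrix whose $(i,j)$ entry is $\alpha^{i+j}$ for $0\le i,j\le n-1$, regarded as a matrix over the additive group $\mathbb{Z}_p^n$, is a $(\mathbb{Z}_p^n, n, 0)$ contracted difference matrix.
   Context: All groups are finite, and abelian groups are written additively. A primitive element of $\mathrm{GF}(p^n)$ is a generator of its multiplicative group. Difference matrix: for a non-trivial group $G$, a $(G,m,\lambda)$ difference matrix is an $m\times\lambda|G|$ matrix $(a_{ij})$ with entries in $G$ such that, for all distinct rows $i$ and $\ell$, the multiset of differences $\{a_{ij}-a_{\ell j} : 0\le j\le \lambda|G|-1\}$ contains each element of $G$ exactly $\lambda$ times. $p$-expansion: let $p$ be prime and let $M$ be a $k\times\ell$ matrix over an abelian $p$-group $G$. The $p$-expansion $f_p(M)$ is the $p^k\times p^\ell$ matrix over $G$ whose rows are indexed by $\mathbf{r}\in\mathbb{Z}_p^k$ and whose columns are indexed by $\mathbf{c}\in\mathbb{Z}_p^\ell$, with $(\mathbf{r},\mathbf{c})$ entry $\mathbf{r}M\mathbf{c}^{\intercal}=\sum_{i,j} r_i c_j M_{ij}$, where $\mathbf r,\mathbf c$ are row vectors whose entries are taken as the integer representatives in $\{0,1,\dots,p-1\}$, and integers act on $G$ in the usual way. Contracted difference matrix: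 let $p$ be prime and let $G$ be an abelian group of order $p^n$. A $k\times(n+s)$ matrix $M$ over $G$ is a $(G,k,s)$ contracted difference matrix if the $p^k\times p^{n+s}$ matrix $f_p(M)$ is a $(G,p^k,p^s)$ difference matrix. *)

theory Defs
  imports
    "HOL-Library.Multiset"
    "HOL-Library.FuncSet"
    "HOL-Computational_Algebra.Primes"
    "HOL-Algebra.Multiplicative_Group"
    "HOL-Algebra.Elementary_Groups"
    "HOL-Algebra.Product_Groups"
begin

text \<open>
  Groups are records of HOL-Algebra, in multiplicative notation: the difference
  \<open>a - b\<close> is \<open>a \<otimes> inv b\<close>, the integer multiple \<open>k a\<close> is \<open>a [^] k\<close>, and a finite sum is
  \<^const>\<open>finprod\<close>. A matrix is a function of a row index and a column index; the index sets
  are explicit, so that a \<open>p\<close>-expansion can be indexed by vectors.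
\<close>

definition difference_matrix ::
  "('g, 'e) monoid_scheme \<Rightarrow> nat \<Rightarrow> nat \<Rightarrow> 'r set \<Rightarrow> 'c set \<Rightarrow> ('r \<Rightarrow> 'c \<Rightarrow> 'g) \<Rightarrow> bool"
  where
  "difference_matrix G m lam R C A \<longleftrightarrow>
     group G \<and> finite (carrier G) \<and> carrier G \<noteq> {\<one>\<^bsub>G\<^esub>} \<and>
     finite R \<and> card R = m \<and> finite C \<and> card C = lam * order G \<and>
     (\<forall>r\<in>R. \<forall>c\<in>C. A r c \<in> carrier G) \<and>
     (\<forall>i\<in>R. \<forall>l\<in>R. i \<noteq> l \<longrightarrow>
        (\<forall>g\<in>carrier G. count {# A i c \<otimes>\<^bsub>G\<^esub> inv\<^bsub>G\<^esub> (A l c). c \<in># mset_set C #} g = lam))"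

text \<open>The vectors in \<open>\<int>\<^sub>p\<^sup>k\<close>, with entries taken as representatives in \<open>{0, \<dots>, p - 1}\<close>.\<close>

definition residue_vectors :: "nat \<Rightarrow> nat \<Rightarrow> (nat \<Rightarrow> nat) set" where
  "residue_vectors p k = {..<k} \<rightarrow>\<^sub>E {..<p}"

text \<open>
  The entry \<open>r M c\<^sup>T\<close> of the \<open>p\<close>-expansion of a \<open>k \<times> l\<close> matrix \<open>M\<close>, for a row index \<open>r\<close> in
  \<open>residue_vectors p k\<close> and a column index \<open>c\<close> in \<open>residue_vectors p l\<close>. The prime \<open>p\<close> enters
  only through these index sets.
\<close>

definition p_expansion ::
  "('g, 'e) monoid_scheme \<Rightarrow> nat \<Rightarrow> nat \<Rightarrow> (nat \<Rightarrow> nat \<Rightarrow> 'g) \<Rightarrow>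
   (nat \<Rightarrow> nat) \<Rightarrow> (nat \<Rightarrow> nat) \<Rightarrow> 'g" where
  "p_expansion G k l M r c =
     finprod G (\<lambda>(i, j). M i j [^]\<^bsub>G\<^esub> (r i * c j)) ({..<k} \<times> {..<l})"

text \<open>The number \<open>n\<close> is determined by \<open>order G = p ^ n\<close>, since \<open>p\<close> is prime.\<close>

definition contracted_difference_matrix ::
  "nat \<Rightarrow> ('g, 'e) monoid_scheme \<Rightarrow> nat \<Rightarrow> nat \<Rightarrow> (nat \<Rightarrow> nat \<Rightarrow> 'g) \<Rightarrow> bool" where
  "contracted_difference_matrix p G k s M \<longleftrightarrow>
     prime p \<and> comm_group G \<and>
     (\<exists>n. order G = p ^ n \<and>
        (\<forall>i<k. \<forall>j<n + s. M i j \<in> carrier G) \<and>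
        difference_matrix G (p ^ k) (p ^ s)
          (residue_vectors p k) (residue_vectors p (n + s)) (p_expansion G k (n + s) M))"

definition primitive_element :: "('a, 'e) ring_scheme \<Rightarrow> 'a \<Rightarrow> bool" where
  "primitive_element F a \<longleftrightarrow>
     a \<in> carrier (mult_of F) \<and> generate (mult_of F) {a} = carrier (mult_of F)"

definition elementary_abelian_group :: "nat \<Rightarrow> nat \<Rightarrow> (nat \<Rightarrow> int) monoid" where
  "elementary_abelian_group p n = product_group {..<n} (\<lambda>_. integer_mod_group p)"

end

theory Submission
  imports Defs "HOL-Number_Theory.Cong"
begin

text \<open>
  Write \<open>S(r)\<close> for the combination \<open>r\<^sub>0 + r\<^sub>1 \<alpha> + \<dots> + r\<^sub>n\<^sub>-\<^sub>1 \<alpha>\<^sup>n\<^sup>-\<^sup>1\<close> given by a residue vector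
  \<open>r\<close>. Since \<open>\<alpha>\<^sup>i\<^sup>+\<^sup>j = \<alpha>\<^sup>i \<alpha>\<^sup>j\<close>, distributivity turns the \<open>(r, c)\<close> entry of the
  \<open>p\<close>-expansion into the product \<open>S(r) S(c)\<close> (\<open>p_expansion_powers\<close>).

  The map \<open>S\<close> is a bijection from the residue vectors onto the field
  (\<open>power_combination_bij\<close>), that is, \<open>1, \<alpha>, \<dots>, \<alpha>\<^sup>n\<^sup>-\<^sup>1\<close> is a basis over the prime field. Hence the
  \<open>p\<close>-expansion is the full multiplication table of the field with rows and columns relabelled.
  In a multiplication table, the difference of the rows \<open>x\<close> and \<open>y\<close> is the row
  \<open>z \<mapsto> (x - y) z\<close>, and for \<open>x \<noteq> y\<close> it is a permutation of the field. So each element occurs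
  exactly once as a difference (\<open>difference_matrix_multiplication_table\<close>).

  Both sides of the bijection have \<open>p\<^sup>n\<close> elements, so only injectivity of \<open>S\<close> is needed. If two
  vectors have the same image and \<open>d\<close> is the largest index at which they differ, division by the
  difference of the two coefficients modulo \<open>p\<close> expresses \<open>\<alpha>\<^sup>d\<close> as a combination of
  \<open>1, \<dots>, \<alpha>\<^sup>d\<^sup>-\<^sup>1\<close>. These combinations are then closed under multiplication by \<open>\<alpha>\<close>, so they
  contain all powers of \<open>\<alpha>\<close> and, as \<open>\<alpha>\<close> is primitive, the whole field. But there are at most
  \<open>p\<^sup>d\<close> of them, and \<open>d < n\<close>.
\<close>

section \<open>Expansions and homomorphisms\<close>

lemma hom_finprod_comm_group:
  assumes "comm_group G" "comm_group H" "h \<in> hom G H"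
    and "f \<in> A \<rightarrow> carrier G"
  shows "h (finprod G f A) = finprod H (\<lambda>x. h (f x)) A"
proof -
  interpret G: comm_group G by fact
  interpret H: comm_group H by fact
  interpret h: group_hom G H h
    using assms by (simp add: group_hom_def group_hom_axioms_def G.is_group H.is_group)
  show ?thesis using assms(4)
  proof (induction A rule: infinite_finite_induct)
    case (insert x A)
    then have "f x \<in> carrier G" "f \<in> A \<rightarrow> carrier G" "(\<lambda>x. h (f x)) \<in> A \<rightarrow> carrier H"
      by (auto simp: Pi_iff)
    then show ?case using insert by simp
  qed auto
qed

text \<open>
  An expansion over a group identified with the additive group of a field can be
  computed inside the field, where products are available, and transported afterwards.
\<close>

lemma p_expansion_hom:
  assumes "comm_group G" "comm_group H" "h \<in> hom G H"
    and M: "\<And>i j. i < k \<Longrightarrow> j < l \<Longrightarrow> M i j \<in> carrier G"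
  shows "p_expansion H k l (\<lambda>i j. h (M i j)) r c = h (p_expansion G k l M r c)"
proof -
  interpret G: comm_group G by fact
  interpret H: comm_group H by fact
  interpret h: group_hom G H h
    using assms by (simp add: group_hom_def group_hom_axioms_def G.is_group H.is_group)
  have "h (p_expansion G k l M r c)
      = finprod H (\<lambda>x. h ((\<lambda>(i, j). M i j [^]\<^bsub>G\<^esub> (r i * c j)) x)) ({..<k} \<times> {..<l})"
    unfolding p_expansion_def
    by (rule hom_finprod_comm_group) (use assms in auto)
  also have "\<dots> = p_expansion H k l (\<lambda>i j. h (M i j)) r c"
    unfolding p_expansion_def
    by (rule H.finprod_cong') (auto simp: M h.hom_nat_pow)
  finally show ?thesis by simp
qed

section \<open>Combinations of powers of a ring element\<close>

text \<open>
  The coefficients are natural numbers, unbounded and without signs, so that entries of residue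
  vectors can be used directly. In characteristic \<open>p\<close> nothing is lost, because \<open>-x = (p - 1) x\<close>.
\<close>

definition power_combination ::
  "('a, 'e) ring_scheme \<Rightarrow> 'a \<Rightarrow> nat \<Rightarrow> (nat \<Rightarrow> nat) \<Rightarrow> 'a" where
  "power_combination R a d r = (\<Oplus>\<^bsub>R\<^esub>i\<in>{..<d}. [r i] \<cdot>\<^bsub>R\<^esub> (a [^]\<^bsub>R\<^esub> i))"

lemma (in semiring) finsum_times_finsum:
  assumes "finite A" "finite B" "f \<in> A \<rightarrow> carrier R" "g \<in> B \<rightarrow> carrier R"
  shows "(\<Oplus>x\<in>A \<times> B. f (fst x) \<otimes> g (snd x)) = (\<Oplus>i\<in>A. f i) \<otimes> (\<Oplus>j\<in>B. g j)"
  using assms(1,3)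
proof (induction A rule: finite_induct)
  case empty
  then show ?case using assms by simp
next
  case (insert a A)
  have a: "a \<notin> A" "f a \<in> carrier R" "f \<in> A \<rightarrow> carrier R" using insert by auto
  have g: "\<And>y. y \<in> B \<Longrightarrow> g y \<in> carrier R" using assms by auto
  have "(\<Oplus>x\<in>insert a A \<times> B. f (fst x) \<otimes> g (snd x))
      = (\<Oplus>x\<in>Pair a ` B \<union> A \<times> B. f (fst x) \<otimes> g (snd x))"
    by (rule arg_cong[where f = "finsum R _"]) auto
  also have "\<dots> = (\<Oplus>x\<in>Pair a ` B. f (fst x) \<otimes> g (snd x)) \<oplus> (\<Oplus>x\<in>A \<times> B. f (fst x) \<otimes> g (snd x))"
    by (rule finsum_Un_disjoint) (use a g insert.hyps assms(2) in \<open>auto simp: Pi_iff\<close>)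
  also have "(\<Oplus>x\<in>Pair a ` B. f (fst x) \<otimes> g (snd x)) = (\<Oplus>y\<in>B. f a \<otimes> g y)"
    by (subst add.finprod_reindex) (use a g in \<open>auto simp: inj_on_def\<close>)
  also have "\<dots> = f a \<otimes> (\<Oplus>y\<in>B. g y)"
    using a assms by (simp add: finsum_rdistr)
  finally show ?case
    using insert.IH[OF a(3)] insert.hyps a assms by (simp add: l_distr)
qed

context cring
begin

lemma power_combination_closed [simp]:
  "a \<in> carrier R \<Longrightarrow> power_combination R a d r \<in> carrier R"
  unfolding power_combination_def by (rule finsum_closed) auto

lemma power_combination_0 [simp]: "power_combination R a 0 r = \<zero>"
  by (simp add: power_combination_def)

lemma power_combination_Suc:
  "a \<in> carrier R \<Longrightarrow>
   power_combination R a (Suc d) r = [r d] \<cdot> (a [^] d) \<oplus> power_combination R a d r"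
  unfolding power_combination_def lessThan_Suc by (subst finsum_insert) auto

lemma power_combination_cong:
  "a \<in> carrier R \<Longrightarrow> (\<And>i. i < d \<Longrightarrow> [r i] \<cdot> (a [^] i) = [s i] \<cdot> (a [^] i)) \<Longrightarrow>
   power_combination R a d r = power_combination R a d s"
  by (induction d) (simp_all add: power_combination_Suc)

lemma power_combination_add:
  assumes "a \<in> carrier R"
  shows "power_combination R a d r \<oplus> power_combination R a d s
    = power_combination R a d (\<lambda>i. r i + s i)"
proof (induction d)
  case (Suc d)
  show ?case using assms
    by (simp add: power_combination_Suc a_ac flip: Suc add.nat_pow_mult)
qed simp

lemma power_combination_scale:
  "a \<in> carrier R \<Longrightarrow>
   [k] \<cdot> power_combination R a d r = power_combination R a d (\<lambda>i. r i * k)"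
  by (induction d) (auto simp: power_combination_Suc add.nat_pow_distrib add.nat_pow_pow)

lemma power_combination_times:
  assumes "a \<in> carrier R"
  shows "a \<otimes> power_combination R a d r = power_combination R a (Suc d) (case_nat 0 r)"
proof (induction d)
  case 0
  show ?case using assms by (simp add: power_combination_Suc)
next
  case (Suc d)
  have "a \<otimes> ([r d] \<cdot> (a [^] d)) = [r d] \<cdot> (a [^] Suc d)"
    using assms by (simp add: add_pow_rdistr m_comm)
  then show ?case using assms Suc
    by (simp add: power_combination_Suc[of a d r] r_distr power_combination_Suc[of a "Suc d"])
qed

lemma power_combination_unit:
  assumes "a \<in> carrier R" "k < d"
  shows "power_combination R a d (\<lambda>i. if i = k then 1 else 0) = a [^] k"
proof -
  have "power_combination R a d (\<lambda>i. if i = k then 1 else 0)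
      = (\<Oplus>i\<in>{..<d}. if k = i then a [^] i else \<zero>)"
    unfolding power_combination_def by (rule finsum_cong') (use assms in auto)
  also have "\<dots> = a [^] k"
    by (rule finsum_singleton) (use assms in auto)
  finally show ?thesis .
qed

text \<open>
  A monic relation of degree \<open>d\<close> makes the span of the lower powers invariant under
  multiplication by \<open>a\<close>: shifting a combination creates at most one term of degree \<open>d\<close>, and the
  relation replaces it by lower terms. This includes \<open>d = 0\<close>, where the hypothesis says \<open>1 = 0\<close>.
\<close>

lemma powers_in_combinations:
  assumes a: "a \<in> carrier R" and d: "a [^] d \<in> range (power_combination R a d)"
  shows "a [^] (k :: nat) \<in> range (power_combination R a d)"
proof (induction k)
  case 0
  show ?case
  proof (cases d)
    case 0
    with d show ?thesis by simp
  next
    case (Suc e)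
    then show ?thesis using power_combination_unit[OF a, of 0 d] by (metis zero_less_Suc rangeI)
  qed
next
  case (Suc k)
  from d obtain s where s: "a [^] d = power_combination R a d s" by auto
  from Suc obtain r where r: "a [^] k = power_combination R a d r" by auto
  let ?r = "case_nat 0 r"
  \<comment> \<open>The term of degree \<open>d\<close> in the shifted combination has coefficient \<open>?r d\<close>.\<close>
  have "a [^] Suc k = a \<otimes> power_combination R a d r"
    using a by (simp add: m_comm flip: r)
  also have "\<dots> = [?r d] \<cdot> power_combination R a d s \<oplus> power_combination R a d ?r"
    using a by (simp add: power_combination_times power_combination_Suc s)
  also have "\<dots> \<in> range (power_combination R a d)"
    using a by (simp add: power_combination_scale power_combination_add)
  finally show ?case .
qed

text \<open>
  The matrix of the powers \<open>a\<^sup>i\<^sup>+\<^sup>j\<close> is the product of a column and a row of powers, so the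
  bilinear form that it defines factors.
\<close>

lemma p_expansion_powers:
  assumes "a \<in> carrier R"
  shows "p_expansion (add_monoid R) k l (\<lambda>i j. a [^] (i + j)) r c
    = power_combination R a k r \<otimes> power_combination R a l c"
proof -
  have "p_expansion (add_monoid R) k l (\<lambda>i j. a [^] (i + j)) r c
    = (\<Oplus>x\<in>{..<k} \<times> {..<l}. ([r (fst x)] \<cdot> (a [^] fst x)) \<otimes> ([c (snd x)] \<cdot> (a [^] snd x)))"
    unfolding p_expansion_def finsum_def[symmetric]
  proof (rule finsum_cong')
    fix x assume "x \<in> {..<k} \<times> {..<l}"
    obtain i j where x: "x = (i, j)" by fastforce
    have "([r i] \<cdot> (a [^] i)) \<otimes> ([c j] \<cdot> (a [^] j)) = [c j] \<cdot> ([r i] \<cdot> (a [^] i \<otimes> a [^] j))"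
      using assms by (simp add: add_pow_ldistr add_pow_rdistr)
    also have "\<dots> = [(r i * c j)] \<cdot> (a [^] (i + j))"
      using assms by (simp add: nat_pow_mult add.nat_pow_pow)
    finally show "(case x of (i, j) \<Rightarrow> (a [^] (i + j)) [^]\<^bsub>add_monoid R\<^esub> (r i * c j))
        = ([r (fst x)] \<cdot> (a [^] fst x)) \<otimes> ([c (snd x)] \<cdot> (a [^] snd x))"
      by (simp add: x add_pow_def)
  qed (use assms in auto)
  also have "\<dots> = power_combination R a k r \<otimes> power_combination R a l c"
    unfolding power_combination_def by (rule finsum_times_finsum) (use assms in auto)
  finally show ?thesis .
qed

end

section \<open>The powers of a primitive element form a basis\<close>

text \<open>
  The additive order of \<open>1\<close> divides \<open>p\<^sup>n\<close>, so \<open>(p 1)\<^sup>n = p\<^sup>n 1 = 0\<close>, and a domain has no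
  nilpotent elements.
\<close>

lemma (in domain) prime_power_order_imp_char:
  assumes "finite (carrier R)" "order R = p ^ n" "x \<in> carrier R"
  shows "[p] \<cdot> x = \<zero>"
proof -
  have "[(p ^ m)] \<cdot> \<one> = \<zero> \<Longrightarrow> [p] \<cdot> \<one> = \<zero>" for m
  proof (induction m)
    case (Suc m)
    have "[(p ^ Suc m)] \<cdot> \<one> = ([p] \<cdot> \<one>) \<otimes> ([(p ^ m)] \<cdot> \<one>)"
      by (simp add: add_pow_ldistr add.nat_pow_pow mult.commute)
    with Suc show ?case using integral[of "[p] \<cdot> \<one>" "[(p ^ m)] \<cdot> \<one>"] by auto
  qed simp
  moreover have "[(p ^ n)] \<cdot> \<one> = \<zero>"
    using add.pow_order_eq_1[of \<one>] assms by (simp add: order_def)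
  ultimately have "[p] \<cdot> \<one> = \<zero>" by blast
  moreover have "[p] \<cdot> x = ([p] \<cdot> \<one>) \<otimes> x" using assms by (simp add: add_pow_ldistr)
  ultimately show ?thesis using assms by simp
qed

lemma (in cring) add_pow_mod_char:
  assumes "[p] \<cdot> x = \<zero>" "x \<in> carrier R"
  shows "[((k :: nat) mod p)] \<cdot> x = [k] \<cdot> x"
proof -
  have "[k] \<cdot> x = [(p * (k div p) + k mod p)] \<cdot> x" by simp
  also have "\<dots> = [(k div p)] \<cdot> ([p] \<cdot> x) \<oplus> [(k mod p)] \<cdot> x"
    using assms(2) by (simp only: add.nat_pow_pow flip: add.nat_pow_mult)
  finally show ?thesis using assms by simp
qed

lemma residue_vectors_finite_card:
  "finite (residue_vectors p k)" "card (residue_vectors p k) = p ^ k"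
  by (auto simp: residue_vectors_def card_funcsetE intro: finite_PiE)

text \<open>
  Reducing the coefficients modulo \<open>p\<close> shows that there are at most \<open>p\<^sup>d\<close> combinations of \<open>d\<close>
  powers.
\<close>

lemma (in cring) range_power_combination:
  assumes "p > 0" "\<And>x. x \<in> carrier R \<Longrightarrow> [p] \<cdot> x = \<zero>" "a \<in> carrier R"
  shows "range (power_combination R a d) = power_combination R a d ` residue_vectors p d"
proof -
  have "power_combination R a d r \<in> power_combination R a d ` residue_vectors p d" for r
  proof (rule image_eqI)
    show "power_combination R a d r = power_combination R a d (\<lambda>i\<in>{..<d}. r i mod p)"
      using assms by (intro power_combination_cong) (auto simp: add_pow_mod_char)
    show "(\<lambda>i\<in>{..<d}. r i mod p) \<in> residue_vectors p d"
      using assms by (auto simp: residue_vectors_def)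
  qed
  then show ?thesis by auto
qed

text \<open>
  The degree of a primitive element over the prime field is at least \<open>n\<close>: a relation of degree
  \<open>d < n\<close> would place all \<open>p\<^sup>n\<close> elements of the field among at most \<open>p\<^sup>d\<close> combinations.
\<close>

lemma (in field) primitive_power_not_combination:
  assumes "prime p" "finite (carrier R)" "order R = p ^ n" "primitive_element R a" "d < n"
  shows "a [^] d \<notin> range (power_combination R a d)"
proof
  assume *: "a [^] d \<in> range (power_combination R a d)"
  have a: "a \<in> carrier R" "a \<in> carrier (mult_of R)"
    and gen: "generate (mult_of R) {a} = carrier (mult_of R)"
    using assms(4) by (auto simp: primitive_element_def)
  interpret m: group "mult_of R" by (rule field_mult_group)
  have char: "\<And>x. x \<in> carrier R \<Longrightarrow> [p] \<cdot> x = \<zero>"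
    using prime_power_order_imp_char assms by blast
  have p: "p > 1" using assms(1) prime_gt_1_nat by blast
  have "x \<in> range (power_combination R a d)" if x: "x \<in> carrier R" for x
  proof (cases "x = \<zero>")
    case True
    have "power_combination R a d (\<lambda>_. 0) = \<zero>"
      using a by (induction d) (auto simp: power_combination_Suc)
    with True show ?thesis by (metis rangeI)
  next
    case False
    have "x \<in> generate (mult_of R) {a}" using gen x False by simp
    then obtain k :: nat where "x = a [^] k"
      using m.generate_pow_on_finite_carrier[OF _ a(2)] assms(2)
      by (auto simp: nat_pow_mult_of)
    then show ?thesis using powers_in_combinations[OF a(1) *] by simp
  qed
  then have "carrier R \<subseteq> power_combination R a d ` residue_vectors p d"
    using range_power_combination[of p a d] char a p by auto
  then have "p ^ n \<le> card (residue_vectors p d)"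
    using assms(3) surj_card_le[OF residue_vectors_finite_card(1)] by (metis order_def)
  also have "\<dots> < p ^ n" using p assms(5) by (simp add: residue_vectors_finite_card)
  finally show False by simp
qed

lemma (in abelian_group) a_left_cancel:
  assumes "x \<oplus> y = x \<oplus> z" "x \<in> carrier G" "y \<in> carrier G" "z \<in> carrier G"
  shows "y = z"
  using assms r_neg1[of x y] r_neg1[of x z] by simp

text \<open>
  A relation whose leading coefficients differ can be made monic, because their difference is
  invertible modulo the prime \<open>p\<close>.
\<close>

lemma (in cring) leading_power_in_combinations:
  assumes p: "prime p" and char: "\<And>x. x \<in> carrier R \<Longrightarrow> [p] \<cdot> x = \<zero>" and a: "a \<in> carrier R"
    and eq: "power_combination R a (Suc d) r = power_combination R a (Suc d) s"
    and lt: "s d < r d" "r d < p"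
  shows "a [^] d \<in> range (power_combination R a d)"
proof -
  let ?S = "power_combination R a d"
  define k where "k = r d - s d"
  have k: "0 < k" "k < p" "r d = s d + k" using lt unfolding k_def by linarith+
  have "[r d] \<cdot> (a [^] d) = [s d] \<cdot> (a [^] d) \<oplus> [k] \<cdot> (a [^] d)"
    unfolding k(3) by (rule add.nat_pow_mult[symmetric]) (use a in simp)
  then have "[s d] \<cdot> (a [^] d) \<oplus> ([k] \<cdot> (a [^] d) \<oplus> ?S r) = [s d] \<cdot> (a [^] d) \<oplus> ?S s"
    using eq a by (simp add: power_combination_Suc a_assoc)
  then have "[k] \<cdot> (a [^] d) \<oplus> ?S r = ?S s" 
    by (rule a_left_cancel) (use a in auto)
  \<comment> \<open>Adding \<open>(p - 1) S(r)\<close> subtracts \<open>S(r)\<close> while keeping natural coefficients.\<close>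
  then have "?S s \<oplus> [(p - 1)] \<cdot> ?S r = [k] \<cdot> (a [^] d) \<oplus> (?S r \<oplus> [(p - 1)] \<cdot> ?S r)"
    using a by (subst a_assoc[symmetric]) auto
  also have "?S r \<oplus> [(p - 1)] \<cdot> ?S r = [Suc (p - 1)] \<cdot> ?S r"
    using a by (simp add: a_comm)
  also have "\<dots> = \<zero>" using prime_gt_0_nat[OF p] a char by (simp del: add.nat_pow_Suc)
  finally obtain t where t: "[k] \<cdot> (a [^] d) = ?S t"
    using a by (simp add: power_combination_scale power_combination_add) metis
  have "\<not> p dvd k" using k(1,2) by (simp add: nat_dvd_not_less)
  then have "coprime k p"
    using p prime_imp_coprime coprime_commute by blast
  then obtain u where "[k * u = Suc 0] (mod p)" using cong_solve_coprime_nat by blast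
  then have "k * u mod p = 1" using prime_gt_1_nat[OF p] by (simp add: cong_def)
  then have "a [^] d = [(k * u)] \<cdot> (a [^] d)"
    using add_pow_mod_char[of p "a [^] d" "k * u"] char a by simp
  also have "\<dots> = [u] \<cdot> ?S t" using a by (simp add: add.nat_pow_pow flip: t)
  finally show ?thesis using a by (simp add: power_combination_scale)
qed

text \<open>
  Linear independence over the prime field. The bound \<open>d\<close> on the degree varies so that equal
  leading coefficients can be cancelled in the induction.
\<close>

lemma (in field) power_combination_unique:
  assumes "prime p" "finite (carrier R)" "order R = p ^ n" "primitive_element R a"
    and "d \<le> n" "\<And>i. i < d \<Longrightarrow> r i < p \<and> s i < p"
    and "power_combination R a d r = power_combination R a d s"
    and "i < d"
  shows "r i = s i"
  using assms(5-8)
proof (induction d arbitrary: i)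
  case (Suc d)
  have a: "a \<in> carrier R" using assms(4) by (auto simp: primitive_element_def)
  have char: "\<And>x. x \<in> carrier R \<Longrightarrow> [p] \<cdot> x = \<zero>"
    using prime_power_order_imp_char assms(2,3) by blast
  have no: "a [^] d \<notin> range (power_combination R a d)"
    using primitive_power_not_combination[OF assms(1-4)] Suc.prems(1) by simp
  have "\<not> s d < r d"
    using leading_power_in_combinations[OF assms(1) char a Suc.prems(3)] no Suc.prems(2)[of d] by auto
  moreover have "\<not> r d < s d"
    using leading_power_in_combinations[OF assms(1) char a Suc.prems(3)[symmetric]] no
      Suc.prems(2)[of d] by auto
  ultimately have top: "r d = s d" by simp
  then have "[s d] \<cdot> (a [^] d) \<oplus> power_combination R a d r
      = [s d] \<cdot> (a [^] d) \<oplus> power_combination R a d s"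
    using Suc.prems(3) a by (simp add: power_combination_Suc)
  then have "power_combination R a d r = power_combination R a d s"
    by (rule a_left_cancel) (use a in auto)
  then have "i < d \<Longrightarrow> r i = s i"
    using Suc.IH Suc.prems(1,2) by simp
  then show ?case using top Suc.prems(4) by (auto simp: less_Suc_eq)
qed simp

lemma (in field) power_combination_bij:
  assumes "prime p" "finite (carrier R)" "order R = p ^ n" "primitive_element R a"
  shows "bij_betw (power_combination R a n) (residue_vectors p n) (carrier R)"
proof -
  have a: "a \<in> carrier R" using assms(4) by (auto simp: primitive_element_def)
  have inj: "inj_on (power_combination R a n) (residue_vectors p n)"
  proof (rule inj_onI)
    fix r s assume rs: "r \<in> residue_vectors p n" "s \<in> residue_vectors p n"
      and eq: "power_combination R a n r = power_combination R a n s"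
    show "r = s"
    proof (rule PiE_ext)
      fix i assume "i \<in> {..<n}"
      then show "r i = s i"
        using power_combination_unique[OF assms order.refl _ eq] rs
        by (auto simp: residue_vectors_def PiE_iff)
    qed (use rs in \<open>auto simp: residue_vectors_def\<close>)
  qed
  have "power_combination R a n ` residue_vectors p n = carrier R"
  proof (rule card_subset_eq)
    show "card (power_combination R a n ` residue_vectors p n) = card (carrier R)"
      using assms(3) by (simp add: card_image[OF inj] residue_vectors_finite_card order_def)
  qed (use a assms in auto)
  with inj show ?thesis by (simp add: bij_betw_def)
qed

section \<open>The multiplication table\<close>

lemma count_image_bij_betw:
  assumes "bij_betw f A B" "finite A" "y \<in> B"
  shows "count {# f x. x \<in># mset_set A #} y = 1"
proof -
  have "{# f x. x \<in># mset_set A #} = mset_set B"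
    using assms by (simp add: bij_betw_def image_mset_mset_set)
  then show ?thesis using assms bij_betw_finite by fastforce
qed

lemma (in field) bij_betw_times:
  assumes "u \<in> carrier R" "u \<noteq> \<zero>"
  shows "bij_betw (\<lambda>x. u \<otimes> x) (carrier R) (carrier R)"
proof (rule bij_betwI[where g = "\<lambda>x. inv u \<otimes> x"])
  have u: "u \<in> Units R" using assms field_Units by auto
  then show "inv u \<otimes> (u \<otimes> x) = x" if "x \<in> carrier R" for x
    using that assms(1) u by (simp add: m_assoc[symmetric])
  show "u \<otimes> (inv u \<otimes> x) = x" if "x \<in> carrier R" for x
    using that assms(1) u by (simp add: m_assoc[symmetric])
qed (use assms field_Units in auto)

text \<open>
  The rows \<open>i\<close> and \<open>l\<close> differ by the row of \<open>u = S i - S l\<close>, which is nonzero because \<open>S\<close> is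
  injective. The columns run once through the field, multiplication by \<open>u\<close> permutes the field,
  and \<open>\<phi>\<close> carries it bijectively to the group.
\<close>

lemma (in field) difference_matrix_multiplication_table:
  assumes H: "group H" and \<phi>: "\<phi> \<in> iso (add_monoid R) H"
    and fin: "finite (carrier R)"
    and S: "bij_betw S C (carrier R)" and C: "finite C" "card C = m"
  shows "difference_matrix H m 1 C C (\<lambda>r c. \<phi> (S r \<otimes> S c))"
proof -
  interpret H: group H by fact
  interpret phi: group_hom "add_monoid R" H \<phi>
    using \<phi> H by (simp add: group_hom_def group_hom_axioms_def iso_def add.is_group)
  have bij: "bij_betw \<phi> (carrier R) (carrier H)" using \<phi> by (simp add: iso_def)
  have S_closed: "\<And>r. r \<in> C \<Longrightarrow> S r \<in> carrier R" using S bij_betwE by blast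
  have "carrier H \<noteq> {\<one>\<^bsub>H\<^esub>}"
  proof
    assume "carrier H = {\<one>\<^bsub>H\<^esub>}"
    then have "\<phi> \<one> = \<phi> \<zero>" using phi.hom_closed by simp
    then show False using bij one_not_zero unfolding bij_betw_def inj_on_def by blast
  qed
  moreover have "finite (carrier H)" using bij fin bij_betw_finite by blast
  moreover have "card C = order H"
    using bij_betw_same_card[OF S] bij_betw_same_card[OF bij] by (simp add: order_def)
  moreover have "count {# \<phi> (S i \<otimes> S c) \<otimes>\<^bsub>H\<^esub> inv\<^bsub>H\<^esub> \<phi> (S l \<otimes> S c). c \<in># mset_set C #} g = 1"
    if il: "i \<in> C" "l \<in> C" "i \<noteq> l" and g: "g \<in> carrier H" for i l g
  proof -
    define u where "u = S i \<ominus> S l"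
    have "S i \<noteq> S l" using S il by (auto simp: bij_betw_def inj_on_def)
    then have u: "u \<in> carrier R" "u \<noteq> \<zero>" using il S_closed by (auto simp: u_def)
    have "\<phi> (S i \<otimes> S c) \<otimes>\<^bsub>H\<^esub> inv\<^bsub>H\<^esub> \<phi> (S l \<otimes> S c) = \<phi> (u \<otimes> S c)" if "c \<in> C" for c
    proof -
      have "u \<otimes> S c = (S i \<otimes> S c) \<oplus> \<ominus> (S l \<otimes> S c)"
        using S_closed il that by (simp add: u_def minus_eq l_distr l_minus)
      then show ?thesis
        using S_closed il that phi.hom_mult[of "S i \<otimes> S c" "\<ominus> (S l \<otimes> S c)"]
          phi.hom_inv[of "S l \<otimes> S c"] by (simp add: a_inv_def)
    qed
    then have table: "{# \<phi> (S i \<otimes> S c) \<otimes>\<^bsub>H\<^esub> inv\<^bsub>H\<^esub> \<phi> (S l \<otimes> S c). c \<in># mset_set C #}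
        = {# (\<phi> \<circ> ((\<lambda>x. u \<otimes> x) \<circ> S)) c. c \<in># mset_set C #}"
      using C by (intro image_mset_cong) auto
    have "bij_betw (\<phi> \<circ> ((\<lambda>x. u \<otimes> x) \<circ> S)) C (carrier H)"
      by (intro bij_betw_trans[OF _ bij] bij_betw_trans[OF S] bij_betw_times u)
    then show ?thesis unfolding table by (rule count_image_bij_betw) (use C g in auto)
  qed
  ultimately show ?thesis
    unfolding difference_matrix_def using H C S_closed phi.hom_closed by auto
qed

lemma group_elementary_abelian_group: "group (elementary_abelian_group p n)"
  by (simp add: elementary_abelian_group_def)

theorem proposition5p6:
  fixes F :: "('a, 'e) ring_scheme"
    and p n :: nat
    and \<alpha> :: 'a
    and \<phi> :: "'a \<Rightarrow> nat \<Rightarrow> int"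
  assumes "prime p" and "n > 0"
    and "field F" and "finite (carrier F)" and "order F = p ^ n"
    and "primitive_element F \<alpha>"
    and "\<phi> \<in> iso (add_monoid F) (elementary_abelian_group p n)"
  shows "contracted_difference_matrix p (elementary_abelian_group p n) n 0
           (\<lambda>i j. \<phi> (\<alpha> [^]\<^bsub>F\<^esub> (i + j)))"
proof -
  interpret F: field F by fact
  let ?E = "elementary_abelian_group p n"
  have a: "\<alpha> \<in> carrier F" using assms(6) by (auto simp: primitive_element_def)
  have E: "group ?E" by (rule group_elementary_abelian_group)
  have iso: "add_monoid F \<cong> ?E" using assms(7) by (auto simp: is_iso_def)
  have comm: "comm_group ?E"
    using F.add.iso_imp_comm_group[OF iso] E by (simp add: group.is_monoid)
  have hom: "\<phi> \<in> hom (add_monoid F) ?E" using assms(7) by (simp add: iso_def)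
  have "p_expansion ?E n n (\<lambda>i j. \<phi> (\<alpha> [^]\<^bsub>F\<^esub> (i + j)))
      = (\<lambda>r c. \<phi> (power_combination F \<alpha> n r \<otimes>\<^bsub>F\<^esub> power_combination F \<alpha> n c))"
  proof (rule ext, rule ext)
    fix r c
    show "p_expansion ?E n n (\<lambda>i j. \<phi> (\<alpha> [^]\<^bsub>F\<^esub> (i + j))) r c
        = \<phi> (power_combination F \<alpha> n r \<otimes>\<^bsub>F\<^esub> power_combination F \<alpha> n c)"
      using p_expansion_hom[OF F.add.comm_group_axioms comm hom] a
      by (simp add: F.p_expansion_powers)
  qed
  then have "difference_matrix ?E (p ^ n) 1 (residue_vectors p n) (residue_vectors p n)
      (p_expansion ?E n n (\<lambda>i j. \<phi> (\<alpha> [^]\<^bsub>F\<^esub> (i + j))))"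
    using F.difference_matrix_multiplication_table[OF E assms(7,4)
        F.power_combination_bij[OF assms(1,4,5,6)] residue_vectors_finite_card]
    by simp
  moreover have "order ?E = p ^ n"
    using iso_same_card[OF iso] assms(5) by (simp add: order_def)
  moreover have "\<phi> (\<alpha> [^]\<^bsub>F\<^esub> (i + j)) \<in> carrier ?E" for i j :: nat
    using hom_in_carrier[OF hom] a by simp
  ultimately show ?thesis
    unfolding contracted_difference_matrix_def using assms(1) comm by auto
qed

end
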